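(* Let $(A,r)$ be a greedy product system with truncation $(A',r)$, let $c\in\mathbb{R}_{\ge0}^E$, and let $k\in\mathbb{Z}_{>0}$. Let $(x^*,y^* )$ be the solution obtained by the revised primal-dual greedy algorithm applied to the truncation, and let $\mathcal{I}_i\subseteq\mathcal{B}$ be the family of tuples whose dual variables were raised in iteration $i$. If each family $\mathcal{I}_i$ has a multiplicity witness-cover of size at most $k|\mathcal{I}_i|$, then $c^Tx^*\le k(\delta+1)\mathrm{OPT}$, where $\mathrm{OPT}$ is the optimal value of (P). If, additionally, the truncation $A'$ is a binary matrix, then $c^Tx^*\le k\,\mathrm{OPT}$.
   Context: Let $E$ be a finite set, $(\mathcal{L},\preceq)$ a lattice (join $\vee$, meet $\wedge$) whose elements are pairwise distinct subsets of $E$, with maximum element $\hat 1$, and $\mathcal{U}$ a finite family (repetitions allowed) of subsets of $E$. Let $\mathcal{B}=\mathcal{U}\times\mathcal{L}$, $A=(a_{(U,S),e})\in\mathbb{R}_{\ge0}^{\mathcal{B}\times E}$ with $\{e: a_{(U,S),e}>0\}=U\cap S$ for all $(U,S)\in\mathcal{B}$, and $r:\mathcal{B}\to\mathbb{R}$. For $U\in\mathcal{U}$, the subsystem $(A,r)_{|U}$ has rows indexed by $S\in\mathcal{L}$, entries $a_{(U,S),e}$ and rank $S\mapsto r(U,S)$. A system with rows indexed by $\mathcal{L}$, matrix $\bar A$, rank $\bar r$ (support $\mathrm{supp}(S)=\{e:\bar a_{S,e}>0\}$) satisfies (P1)–(P4) if: (P1) $\bar r(S)\le\bar r(T)$ whenever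 $S\preceq T$; (P2) $\bar a_{S,e}\le\bar a_{T,e}$ for all $e$ whenever $S\preceq T$; (P3) $(\mathcal{L},\preceq)$ is a modular lattice, distinct rows have distinct supports, and $e\notin\mathrm{supp}(S)\cup\mathrm{supp}(T)$ implies $e\notin\mathrm{supp}(S\vee T)$; (P4) $\frac{\bar r(T)-\bar r(S\wedge T)}{\bar a_{T,e}}\le\frac{\bar r(S\vee T)-\bar r(S)}{\bar a_{S\vee T,e}}$ for all $S,T\in\mathcal{L}$ and $e\in\mathrm{supp}(T)\setminus\mathrm{supp}(S\wedge T)$. $(A,r)$ is a greedy product system if $(A,r)_{|U}$ satisfies (P1)–(P4) for every $U\in\mathcal{U}$. For $S\in\mathcal{L}$, $e\in E$: $\varphi_e(S)=\max\{T\in\mathcal{L}: T\preceq S, e\notin T\}$; $t^+=\max\{t,0\}$. The truncation $(A',r)$ has $a'_{(U,S),e}=\min\{a_{(U,S),e},\ r(U,S)^+-r(U,\varphi_e(S))^+\}$. Problem (P): $\min\{c^Tx: Ax\ge r, x\in\mathbb{Z}^E_{\ge0}\}$. For each $S\in\mathcal{L}$ a partial order $\preceq_S$ on $\mathcal{U}$ is given, and $\mathcal{B}$ is ordered lexicographically: $(U,S)\preceq_{\mathcal{B}}(U',S')$ iff $S\prec S'$, or $S=S'$ and $r(U,S)<r(U',S')$, or $S=S'$, $r(U,S)=r(U',S')$ and $U\preceq_S U'$. For $e\in E$ and $\mathcal{B}'\subseteq\mathcal{B}$, $\mathcal{B}'\setminus\{e\}=\{(U,S)\in\mathcal{B}':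 e\notin S\}$. Revised primal-dual greedy algorithm: start with $y^*\equiv0$, $x^*\equiv0$, $E^*=\emptyset$, current family $\mathcal{B}'=\mathcal{B}$. While $\mathcal{B}'\ne\emptyset$: let $B$ be the set of maximal tuples of $\mathcal{B}'$ w.r.t. $\preceq_{\mathcal{B}}$ (they share a common $S\in\mathcal{L}$ and a common rank value); stop if $r(U,S)\le 0$ for $(U,S)\in B$; raise $y^*_{(U,S)}$ for all $(U,S)\in B$ uniformly until some $e^*\in E\setminus E^*$ becomes tight, i.e. $\sum_{(U,S)\in\mathcal{B}}a'_{(U,S),e^*}y^*_{(U,S)}=c_{e^*}$; with $S'=\varphi_{e^*}(S)$ set $x^*_{e^*}=\max\{\lceil (r(W,S)^+-r(W,S')^+)/a'_{(W,S),e^*}\rceil: W\in\mathcal{U}, a'_{(W,S),e^*}>0\}$; add $e^*$ to $E^*$ and replace $\mathcal{B}'$ by $\mathcal{B}'\setminus\{e^*\}$. Finally (cleanup), for the bottleneck elements $e^*\in E^*$ in reverse order of selection, decrease $x^*_{e^*}$ as long as the solution remains feasible for all rows $(U,S)\in\mathcal{B}$ of $A'x\ge r$. Given the final $x^*$, a tuple $(U,S)\in\mathcal{B}$ is a witness of an element $e$ if $\sum_{f\in U\cap S}a'_{(U,S),f}x^*_f-a'_{(U,S),e}<r(U,S)\le\sum_{f\in U\cap S}a'_{(U,S),f}x^*_f$. For a family $\mathcal{I}$ of tuples raised simultaneously in one iteration, with common rank $r^*$, a family $\mathcal{C}\subseteq\mathcal{B}$ is a multiplicity witness-cover of $\mathcal{I}$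 if every tuple of $\mathcal{C}$ is a witness for some element, $r(U,S)\le r^*$ for all $(U,S)\in\mathcal{C}$, and for every $e\in E$: $|\{(U,S)\in\mathcal{I}: a'_{(U,S),e}x^*_e>0\}|\le|\{(U,S)\in\mathcal{C}: a'_{(U,S),e}x^*_e>0\}|$. For $U,W\in\mathcal{U}$, $S\in\mathcal{L}$, $e\in E$, let $\delta_{U,(W,S),e}=a'_{(U,\hat1),e}/a'_{(W,S),e}$ if $a'_{(W,S),e}>0$ and ($r(W,\varphi_e(S))\ge0$ or $a'_{(W,S),e}=a_{(W,S),e}$), and $\delta_{U,(W,S),e}=1$ otherwise; $\delta=\max_{U,(W,S),e}\delta_{U,(W,S),e}$.
   Formalization: A tuple counts as a witness of an element e only if, besides the two displayed inequalities, x*_e > 0; without this condition the k(δ+1) bound fails, since a tuple could be a "witness" of an element that x* does not use. *)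

theory Defs
  imports Complex_Main "HOL-Algebra.Lattice"
begin

section \<open>Greedy systems\<close>

definition modular_lattice :: "'a gorder \<Rightarrow> bool" where
  "modular_lattice L \<longleftrightarrow> lattice L \<and>
     (\<forall>x\<in>carrier L. \<forall>y\<in>carrier L. \<forall>z\<in>carrier L.
        x \<sqsubseteq>\<^bsub>L\<^esub> z \<longrightarrow> x \<squnion>\<^bsub>L\<^esub> (y \<sqinter>\<^bsub>L\<^esub> z) = (x \<squnion>\<^bsub>L\<^esub> y) \<sqinter>\<^bsub>L\<^esub> z)"

definition supp :: "'e set \<Rightarrow> ('e set \<Rightarrow> 'e \<Rightarrow> real) \<Rightarrow> 'e set \<Rightarrow> 'e set" where
  "supp E a S = {e\<in>E. a S e > 0}"

text \<open>The four conjuncts are the properties (P1), (P2), (P3) and (P4).\<close>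

definition greedy_system ::
  "'e set \<Rightarrow> 'e set gorder \<Rightarrow> ('e set \<Rightarrow> 'e \<Rightarrow> real) \<Rightarrow> ('e set \<Rightarrow> real) \<Rightarrow> bool" where
  "greedy_system E L a r \<longleftrightarrow>
     (\<forall>S\<in>carrier L. \<forall>T\<in>carrier L. S \<sqsubseteq>\<^bsub>L\<^esub> T \<longrightarrow> r S \<le> r T) \<and>
     (\<forall>S\<in>carrier L. \<forall>T\<in>carrier L. S \<sqsubseteq>\<^bsub>L\<^esub> T \<longrightarrow> (\<forall>e\<in>E. a S e \<le> a T e)) \<and>
     (modular_lattice L \<and>
      inj_on (supp E a) (carrier L) \<and>
      (\<forall>S\<in>carrier L. \<forall>T\<in>carrier L. \<forall>e\<in>E.
         e \<notin> supp E a S \<union> supp E a T \<longrightarrow> e \<notin> supp E a (S \<squnion>\<^bsub>L\<^esub> T))) \<and>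
     (\<forall>S\<in>carrier L. \<forall>T\<in>carrier L. \<forall>e \<in> supp E a T - supp E a (S \<sqinter>\<^bsub>L\<^esub> T).
        (r T - r (S \<sqinter>\<^bsub>L\<^esub> T)) / a T e \<le> (r (S \<squnion>\<^bsub>L\<^esub> T) - r S) / a (S \<squnion>\<^bsub>L\<^esub> T) e)"

section \<open>Product systems\<close>

text \<open>
  The family of subsets of the ground set may contain repetitions, so it is given by a set
  \<open>fam\<close> of indices together with the subset \<open>mem U\<close> belonging to each index \<open>U\<close>.  The lattice
  elements are themselves subsets of the ground set, ordered by an arbitrary lattice order
  (which need not be inclusion).
\<close>

record ('e, 'u) product_system =
  ground :: "'e set"
  lat :: "'e set gorder"
  fam :: "'u set"
  mem :: "'u \<Rightarrow> 'e set"
  mat :: "'u \<Rightarrow> 'e set \<Rightarrow> 'e \<Rightarrow> real"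
  rk :: "'u \<Rightarrow> 'e set \<Rightarrow> real"

definition rows :: "('e, 'u) product_system \<Rightarrow> ('u \<times> 'e set) set" where
  "rows P = fam P \<times> carrier (lat P)"

definition product_system :: "('e, 'u) product_system \<Rightarrow> bool" where
  "product_system P \<longleftrightarrow>
     finite (ground P) \<and>
     carrier (lat P) \<subseteq> Pow (ground P) \<and> lattice (lat P) \<and>
     (\<exists>S. greatest (lat P) S (carrier (lat P))) \<and>
     finite (fam P) \<and> (\<forall>U\<in>fam P. mem P U \<subseteq> ground P) \<and>
     (\<forall>(U, S)\<in>rows P. \<forall>e\<in>ground P. 0 \<le> mat P U S e) \<and>
     (\<forall>(U, S)\<in>rows P. {e\<in>ground P. mat P U S e > 0} = mem P U \<inter> S)"

definition greedy_product_system :: "('e, 'u) product_system \<Rightarrow> bool" where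
  "greedy_product_system P \<longleftrightarrow> product_system P \<and>
     (\<forall>U\<in>fam P. greedy_system (ground P) (lat P) (mat P U) (rk P U))"

text \<open>
  \<open>phi P e S\<close> is the maximum of the lattice elements below \<open>S\<close> that avoid \<open>e\<close>.  It is \<open>None\<close> if
  there is no maximum; in a greedy product system, for an element \<open>e\<close> of some member of the family,
  this happens only if every lattice element below \<open>S\<close> contains \<open>e\<close>.
\<close>

definition below_avoiding :: "('e, 'u) product_system \<Rightarrow> 'e \<Rightarrow> 'e set \<Rightarrow> 'e set set" where
  "below_avoiding P e S = {T\<in>carrier (lat P). T \<sqsubseteq>\<^bsub>lat P\<^esub> S \<and> e \<notin> T}"

definition phi :: "('e, 'u) product_system \<Rightarrow> 'e \<Rightarrow> 'e set \<Rightarrow> 'e set option" where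
  "phi P e S =
     (if \<exists>T. greatest (lat P) T (below_avoiding P e S)
      then Some (THE T. greatest (lat P) T (below_avoiding P e S)) else None)"

text \<open>
  \<open>rk_drop P U S e\<close> is the rank difference \<open>r(U,S)\<^sup>+ - r(U,\<phi>\<^sub>e(S))\<^sup>+\<close>.  If \<open>phi P e S\<close> is undefined,
  the second term is read as 0, as for an additional bottom row of rank at most 0.
\<close>

definition rk_drop :: "('e, 'u) product_system \<Rightarrow> 'u \<Rightarrow> 'e set \<Rightarrow> 'e \<Rightarrow> real" where
  "rk_drop P U S e =
     max (rk P U S) 0 - (case phi P e S of None \<Rightarrow> 0 | Some T \<Rightarrow> max (rk P U T) 0)"

definition trunc :: "('e, 'u) product_system \<Rightarrow> 'u \<Rightarrow> 'e set \<Rightarrow> 'e \<Rightarrow> real" where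
  "trunc P U S e = min (mat P U S e) (rk_drop P U S e)"

definition delta_entry ::
  "('e, 'u) product_system \<Rightarrow> 'u \<Rightarrow> 'u \<Rightarrow> 'e set \<Rightarrow> 'e \<Rightarrow> real" where
  "delta_entry P U W S e =
     (if trunc P W S e > 0 \<and>
         ((\<exists>T. phi P e S = Some T \<and> rk P W T \<ge> 0) \<or> trunc P W S e = mat P W S e)
      then trunc P U \<top>\<^bsub>lat P\<^esub> e / trunc P W S e else 1)"

definition delta :: "('e, 'u) product_system \<Rightarrow> real" where
  "delta P = Max {delta_entry P U W S e | U W S e.
     U \<in> fam P \<and> W \<in> fam P \<and> S \<in> carrier (lat P) \<and> e \<in> ground P}"

section \<open>The integer program\<close>

definition cost :: "('e, 'u) product_system \<Rightarrow> ('e \<Rightarrow> real) \<Rightarrow> ('e \<Rightarrow> nat) \<Rightarrow> real" where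
  "cost P c x = (\<Sum>e\<in>ground P. c e * real (x e))"

definition feasible ::
  "('e, 'u) product_system \<Rightarrow> ('u \<Rightarrow> 'e set \<Rightarrow> 'e \<Rightarrow> real) \<Rightarrow> ('e \<Rightarrow> nat) \<Rightarrow> bool" where
  "feasible P M x \<longleftrightarrow> (\<forall>(U, S)\<in>rows P. rk P U S \<le> (\<Sum>e\<in>ground P. M U S e * real (x e)))"

definition is_optimal_value :: "('e, 'u) product_system \<Rightarrow> ('e \<Rightarrow> real) \<Rightarrow> real \<Rightarrow> bool" where
  "is_optimal_value P c v \<longleftrightarrow>
     (\<exists>x. feasible P (mat P) x \<and> cost P c x = v) \<and>
     (\<forall>x. feasible P (mat P) x \<longrightarrow> v \<le> cost P c x)"

section \<open>The revised primal-dual greedy algorithm\<close>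

text \<open>\<open>Q S\<close> is the partial order on the family that breaks ties at the lattice element \<open>S\<close>.\<close>

definition row_le ::
  "('e, 'u) product_system \<Rightarrow> ('e set \<Rightarrow> 'u rel) \<Rightarrow> 'u \<times> 'e set \<Rightarrow> 'u \<times> 'e set \<Rightarrow> bool" where
  "row_le P Q p q \<longleftrightarrow> (case (p, q) of ((U, S), (U', S')) \<Rightarrow>
     S \<sqsubset>\<^bsub>lat P\<^esub> S' \<or>
     S = S' \<and> rk P U S < rk P U' S' \<or>
     S = S' \<and> rk P U S = rk P U' S' \<and> (U, U') \<in> Q S)"

definition maximal_rows ::
  "('e, 'u) product_system \<Rightarrow> ('e set \<Rightarrow> 'u rel) \<Rightarrow> ('u \<times> 'e set) set \<Rightarrow> ('u \<times> 'e set) set" where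
  "maximal_rows P Q B = {p\<in>B. \<forall>q\<in>B. row_le P Q p q \<longrightarrow> q = p}"

definition remove_elem :: "'e \<Rightarrow> ('u \<times> 'e set) set \<Rightarrow> ('u \<times> 'e set) set" where
  "remove_elem e B = {(U, S)\<in>B. e \<notin> S}"

definition load :: "('e, 'u) product_system \<Rightarrow> ('u \<times> 'e set \<Rightarrow> real) \<Rightarrow> 'e \<Rightarrow> real" where
  "load P y e = (\<Sum>(U, S)\<in>rows P. trunc P U S e * y (U, S))"

text \<open>
  An element with no positive entry in the rows of \<open>S\<close> can only be selected if it was tight before
  the dual variables were raised (for instance if its cost is 0).  The maximum then ranges over
  the empty set and the primal variable stays 0; in all other cases the quotients are at least 1.
\<close>

definition primal_value :: "('e, 'u) product_system \<Rightarrow> 'e set \<Rightarrow> 'e \<Rightarrow> nat" where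
  "primal_value P S e =
     (if \<exists>W\<in>fam P. trunc P W S e > 0
      then Max {nat \<lceil>rk_drop P W S e / trunc P W S e\<rceil> | W. W \<in> fam P \<and> trunc P W S e > 0}
      else 0)"

text \<open>
  \<open>greedy_run P Q c y x es Is B\<close>: after some number of iterations of the main loop the algorithm
  can have dual solution \<open>y\<close>, primal solution \<open>x\<close> and current family \<open>B\<close>; \<open>es\<close> lists the selected
  bottleneck elements and \<open>Is\<close> the raised families, both in order of selection.
  The raise \<open>eps\<close> is the first one (possibly 0) at which some unselected element is tight: no
  unselected element exceeds its cost and the selected one attains it.  Ties between tight
  elements are broken arbitrarily.
\<close>

inductive greedy_run ::
  "('e, 'u) product_system \<Rightarrow> ('e set \<Rightarrow> 'u rel) \<Rightarrow> ('e \<Rightarrow> real) \<Rightarrow>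
   ('u \<times> 'e set \<Rightarrow> real) \<Rightarrow> ('e \<Rightarrow> nat) \<Rightarrow> 'e list \<Rightarrow> ('u \<times> 'e set) set list \<Rightarrow>
   ('u \<times> 'e set) set \<Rightarrow> bool"
  for P :: "('e, 'u) product_system" and Q :: "'e set \<Rightarrow> 'u rel" and c :: "'e \<Rightarrow> real" where
  start: "greedy_run P Q c (\<lambda>_. 0) (\<lambda>_. 0) [] [] (rows P)"
| iteration: "greedy_run P Q c y' (x(e := primal_value P S e)) (es @ [e]) (Is @ [I]) (remove_elem e B)"
  if "greedy_run P Q c y x es Is B"
    and "B \<noteq> {}"
    and "I = maximal_rows P Q B"
    and "\<forall>(U, T)\<in>I. T = S \<and> rk P U T = rho"
    and "rho > 0"
    and "eps \<ge> 0"
    and "y' = (\<lambda>p. if p \<in> I then y p + eps else y p)"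
    and "\<forall>f \<in> ground P - set es. load P y' f \<le> c f"
    and "e \<in> ground P - set es"
    and "load P y' e = c e"

primrec decrease :: "(('e \<Rightarrow> nat) \<Rightarrow> bool) \<Rightarrow> 'e \<Rightarrow> ('e \<Rightarrow> nat) \<Rightarrow> nat \<Rightarrow> ('e \<Rightarrow> nat)" where
  "decrease ok e x 0 = x(e := 0)"
| "decrease ok e x (Suc n) = (if ok (x(e := n)) then decrease ok e x n else x(e := Suc n))"

definition cleanup :: "('e, 'u) product_system \<Rightarrow> 'e list \<Rightarrow> ('e \<Rightarrow> nat) \<Rightarrow> ('e \<Rightarrow> nat)" where
  "cleanup P es x = fold (\<lambda>e z. decrease (feasible P (trunc P)) e z (z e)) (rev es) x"

definition algorithm_output ::
  "('e, 'u) product_system \<Rightarrow> ('e set \<Rightarrow> 'u rel) \<Rightarrow> ('e \<Rightarrow> real) \<Rightarrow>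
   ('e \<Rightarrow> nat) \<Rightarrow> ('u \<times> 'e set \<Rightarrow> real) \<Rightarrow> ('u \<times> 'e set) set list \<Rightarrow> bool" where
  "algorithm_output P Q c x y Is \<longleftrightarrow>
     (\<exists>x0 es B. greedy_run P Q c y x0 es Is B \<and>
        (B = {} \<or> (\<forall>(U, S)\<in>maximal_rows P Q B. rk P U S \<le> 0)) \<and>
        x = cleanup P es x0)"

section \<open>Witnesses\<close>

text \<open>
  \<open>(U, S)\<close> is a witness of \<open>e\<close> if the row is satisfied by \<open>x\<close> but no longer after one unit of \<open>e\<close>
  is taken away.  This presupposes that \<open>x\<close> uses \<open>e\<close>, which the inequalities alone do not imply.
\<close>

definition witness ::
  "('e, 'u) product_system \<Rightarrow> ('e \<Rightarrow> nat) \<Rightarrow> 'u \<times> 'e set \<Rightarrow> 'e \<Rightarrow> bool" where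
  "witness P x p e \<longleftrightarrow> (case p of (U, S) \<Rightarrow>
     x e > 0 \<and>
     (\<Sum>f\<in>mem P U \<inter> S. trunc P U S f * real (x f)) - trunc P U S e < rk P U S \<and>
     rk P U S \<le> (\<Sum>f\<in>mem P U \<inter> S. trunc P U S f * real (x f)))"

text \<open>All rows of a raised family \<open>I\<close> have the same rank, so comparing with each of them is
  comparing with the common rank.\<close>

definition multiplicity_witness_cover ::
  "('e, 'u) product_system \<Rightarrow> ('e \<Rightarrow> nat) \<Rightarrow> ('u \<times> 'e set) set \<Rightarrow> ('u \<times> 'e set) set \<Rightarrow> bool" where
  "multiplicity_witness_cover P x I C \<longleftrightarrow>
     C \<subseteq> rows P \<and>
     (\<forall>p\<in>C. \<exists>e\<in>ground P. witness P x p e) \<and>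
     (\<forall>(U, S)\<in>C. \<forall>(V, T)\<in>I. rk P U S \<le> rk P V T) \<and>
     (\<forall>e\<in>ground P.
        card {(U, S)\<in>I. trunc P U S e * real (x e) > 0}
          \<le> card {(U, S)\<in>C. trunc P U S e * real (x e) > 0})"

end

theory Submission
  imports Defs
begin

text \<open>
  The algorithm keeps the dual solution feasible and every selected element tight, so the cost of
  the output is the total over the raised families of the raise times the left-hand sides of their
  rows. In a family of rank \<open>\<rho>\<close> these left-hand sides are charged to the rows of its
  witness-cover: all but one unit of the witnessed element costs at most \<open>\<delta>\<close> times the rank of the
  covering row, and the remaining unit costs at most \<open>\<rho>\<close>, because truncated entries never exceed the
  rank. Weak duality bounds the sum of rank times dual value by OPT, since every feasible integer
  point also satisfies the truncated system. If the truncation is binary, the left-hand side of a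
  covering row is the rounded up rank, and weak duality holds with rounded up ranks as well.
\<close>

section \<open>Counting, cleanup and exchange of summation\<close>

text \<open>Any injection of \<open>I\<close> into \<open>C\<close> works, since the bound holds for
  all pairs; unmatched weights are nonnegative. This turns the cardinality condition of a
  witness-cover into an inequality of sums.\<close>

lemma sum_le_sum_of_card_le:
  fixes g :: "'a \<Rightarrow> real" and w :: "'b \<Rightarrow> real"
  assumes "finite I" "finite C" "card I \<le> card C"
    and le: "\<And>p q. p \<in> I \<Longrightarrow> q \<in> C \<Longrightarrow> g p \<le> w q"
    and nonneg: "\<And>q. q \<in> C \<Longrightarrow> 0 \<le> w q"
  shows "sum g I \<le> sum w C"
proof -
  obtain i where i: "i ` I \<subseteq> C" "inj_on i I"
    using card_le_inj[OF assms(1-3)] by blast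
  have "sum g I \<le> sum (w \<circ> i) I"
    using i le by (auto intro!: sum_mono)
  also have "\<dots> = sum w (i ` I)"
    using i by (simp add: sum.reindex)
  also have "\<dots> \<le> sum w C"
    using i assms nonneg by (intro sum_mono2) auto
  finally show ?thesis .
qed

lemma rk_drop_le: "rk_drop P U S e \<le> max (rk P U S) 0"
  by (simp add: rk_drop_def split: option.split)

lemma trunc_le_rk: "trunc P U S e \<le> max (rk P U S) 0"
  using rk_drop_le[of P U S e] by (simp add: trunc_def)

lemma decrease_other: "f \<noteq> e \<Longrightarrow> decrease ok e x n f = x f"
  by (induction n arbitrary: x) auto

text \<open>Together with the invariant of the run, this confines the support of the output to
  selected, hence tight, elements.\<close>

lemma cleanup_other:
  assumes "f \<notin> set es"
  shows "cleanup P es x f = x f"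
proof -
  have "fold (\<lambda>e z. decrease (feasible P (trunc P)) e z (z e)) fs x f = x f"
    if "f \<notin> set fs" for fs
    using that by (induction fs arbitrary: x) (auto simp: decrease_other)
  then show ?thesis using assms by (simp add: cleanup_def)
qed

text \<open>Double counting over the truncated matrix: with the output for \<open>z\<close> it
  yields the cost, with a feasible point it yields weak duality.\<close>

lemma sum_load:
  "(\<Sum>e\<in>ground P. load P y e * z e) =
    (\<Sum>p\<in>rows P. y p * (\<Sum>e\<in>ground P. trunc P (fst p) (snd p) e * z e))"
proof -
  have "(\<Sum>e\<in>ground P. load P y e * z e) =
      (\<Sum>e\<in>ground P. \<Sum>p\<in>rows P. y p * (trunc P (fst p) (snd p) e * z e))"
    by (simp add: load_def case_prod_unfold sum_distrib_left mult_ac)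
  also have "\<dots> = (\<Sum>p\<in>rows P. \<Sum>e\<in>ground P. y p * (trunc P (fst p) (snd p) e * z e))"
    by (rule sum.swap)
  finally show ?thesis by (simp add: sum_distrib_left)
qed

lemma integral_row_eq_of_int:
  assumes "\<forall>e\<in>ground P. trunc P U S e \<in> {0, 1}"
  obtains n :: int where "(\<Sum>e\<in>ground P. trunc P U S e * real (z e)) = of_int n"
proof -
  have "(\<Sum>e\<in>ground P. trunc P U S e * real (z e)) \<in> \<int>"
    using assms by (intro Ints_sum) auto
  then show ?thesis using that by (auto elim: Ints_cases)
qed

section \<open>Truncation\<close>

context
  fixes P :: "('e, 'u) product_system"
  assumes greedy: "greedy_product_system P"
begin

lemma finite_ground: "finite (ground P)"
  and carrier_Pow: "carrier (lat P) \<subseteq> Pow (ground P)"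
  and lattice_lat: "lattice (lat P)"
  and finite_fam: "finite (fam P)"
  and top_ex: "\<exists>S. greatest (lat P) S (carrier (lat P))"
  using greedy unfolding greedy_product_system_def product_system_def by auto

lemma finite_carrier: "finite (carrier (lat P))"
  using finite_subset[OF carrier_Pow] finite_ground by simp

lemma finite_rows: "finite (rows P)"
  unfolding rows_def using finite_fam finite_carrier by simp

lemma mem_carrier_subset_ground: "U \<in> fam P \<Longrightarrow> mem P U \<inter> S \<subseteq> ground P"
  using greedy unfolding greedy_product_system_def product_system_def by blast

lemma mat_nonneg:
  "U \<in> fam P \<Longrightarrow> S \<in> carrier (lat P) \<Longrightarrow> e \<in> ground P \<Longrightarrow> 0 \<le> mat P U S e"
  using greedy unfolding greedy_product_system_def product_system_def rows_def by auto

lemma mat_pos_iff: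
  assumes "U \<in> fam P" "S \<in> carrier (lat P)" "e \<in> ground P"
  shows "0 < mat P U S e \<longleftrightarrow> e \<in> mem P U \<and> e \<in> S"
proof -
  have "{e\<in>ground P. mat P U S e > 0} = mem P U \<inter> S"
    using greedy assms unfolding greedy_product_system_def product_system_def rows_def by auto
  then show ?thesis using assms by blast
qed

lemma greedy_system_fam:
  "U \<in> fam P \<Longrightarrow> greedy_system (ground P) (lat P) (mat P U) (rk P U)"
  using greedy unfolding greedy_product_system_def by auto

lemma rk_mono:
  "U \<in> fam P \<Longrightarrow> S \<in> carrier (lat P) \<Longrightarrow> T \<in> carrier (lat P) \<Longrightarrow> S \<sqsubseteq>\<^bsub>lat P\<^esub> T
    \<Longrightarrow> rk P U S \<le> rk P U T"
  using greedy_system_fam unfolding greedy_system_def by blast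

lemma mat_mono:
  "U \<in> fam P \<Longrightarrow> S \<in> carrier (lat P) \<Longrightarrow> T \<in> carrier (lat P) \<Longrightarrow> S \<sqsubseteq>\<^bsub>lat P\<^esub> T
    \<Longrightarrow> e \<in> ground P \<Longrightarrow> mat P U S e \<le> mat P U T e"
  using greedy_system_fam unfolding greedy_system_def by blast

lemma rk_gain_le:
  assumes "U \<in> fam P" "S \<in> carrier (lat P)" "T \<in> carrier (lat P)"
    and "e \<in> ground P" "0 < mat P U T e" "\<not> 0 < mat P U (S \<sqinter>\<^bsub>lat P\<^esub> T) e"
  shows "(rk P U T - rk P U (S \<sqinter>\<^bsub>lat P\<^esub> T)) / mat P U T e
    \<le> (rk P U (S \<squnion>\<^bsub>lat P\<^esub> T) - rk P U S) / mat P U (S \<squnion>\<^bsub>lat P\<^esub> T) e"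
proof -
  have "e \<in> supp (ground P) (mat P U) T - supp (ground P) (mat P U) (S \<sqinter>\<^bsub>lat P\<^esub> T)"
    using assms by (simp add: supp_def)
  then show ?thesis
    using greedy_system_fam[OF assms(1)] assms(2,3) unfolding greedy_system_def by blast
qed

section \<open>The map \<phi>_e and monotonicity of the truncation\<close>

lemma phi_eq_Some_iff:
  "phi P e S = Some T \<longleftrightarrow> greatest (lat P) T (below_avoiding P e S)"
proof -
  interpret lattice "lat P" by (rule lattice_lat)
  have "(THE T'. greatest (lat P) T' (below_avoiding P e S)) = T"
    if "greatest (lat P) T (below_avoiding P e S)" for T
    using that by (rule the_equality) (rule greatest_unique[OF _ that])
  then show ?thesis unfolding phi_def by auto
qed

lemma phi_SomeD:
  assumes "phi P e S = Some T"
  shows "T \<in> carrier (lat P)" "T \<sqsubseteq>\<^bsub>lat P\<^esub> S" "e \<notin> T"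
    and "\<And>T'. T' \<in> carrier (lat P) \<Longrightarrow> T' \<sqsubseteq>\<^bsub>lat P\<^esub> S \<Longrightarrow> e \<notin> T' \<Longrightarrow> T' \<sqsubseteq>\<^bsub>lat P\<^esub> T"
  using assms unfolding phi_eq_Some_iff greatest_def below_avoiding_def by auto

lemma rk_drop_nonneg:
  assumes "U \<in> fam P" "S \<in> carrier (lat P)"
  shows "0 \<le> rk_drop P U S e"
proof (cases "phi P e S")
  case (Some T)
  then have "rk P U T \<le> rk P U S"
    using rk_mono assms phi_SomeD by blast
  then show ?thesis using Some by (simp add: rk_drop_def)
qed (simp add: rk_drop_def)

lemma trunc_nonneg:
  "U \<in> fam P \<Longrightarrow> S \<in> carrier (lat P) \<Longrightarrow> e \<in> ground P \<Longrightarrow> 0 \<le> trunc P U S e"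
  by (simp add: trunc_def mat_nonneg rk_drop_nonneg)

lemma trunc_eq_0:
  assumes "U \<in> fam P" "S \<in> carrier (lat P)" "e \<in> ground P" "e \<notin> mem P U \<inter> S"
  shows "trunc P U S e = 0"
proof -
  have "mat P U S e = 0"
    using mat_pos_iff[OF assms(1-3)] mat_nonneg[OF assms(1-3)] assms(4) by auto
  then show ?thesis using rk_drop_nonneg[OF assms(1,2)] by (simp add: trunc_def)
qed

lemma sum_ground_eq_sum_row:
  assumes "U \<in> fam P" "S \<in> carrier (lat P)"
  shows "(\<Sum>e\<in>ground P. trunc P U S e * z e) = (\<Sum>e\<in>mem P U \<inter> S. trunc P U S e * z e)"
  using assms by (intro sum.mono_neutral_right)
    (auto simp: finite_ground trunc_eq_0 dest: mem_carrier_subset_ground[THEN subsetD, of U e for e])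

text \<open>Apply (P4) to \<open>R\<close> = \<phi>_e(T) and \<open>S\<close>: their meet is
  \<phi>_e(S), and their join lies below \<open>T\<close>. If \<phi>_e(T) is undefined, nothing is
  subtracted on the right.\<close>

lemma rk_drop_mono:
  assumes U: "U \<in> fam P" and e: "e \<in> mem P U"
    and S: "S \<in> carrier (lat P)" and T: "T \<in> carrier (lat P)" and ST: "S \<sqsubseteq>\<^bsub>lat P\<^esub> T"
    and eS: "e \<in> S"
  shows "rk_drop P U S e \<le> rk_drop P U T e"
proof (cases "phi P e T")
  case None
  have "rk_drop P U S e \<le> max (rk P U S) 0" by (rule rk_drop_le)
  also have "\<dots> \<le> rk_drop P U T e"
    using None rk_mono[OF U S T ST] by (simp add: rk_drop_def)
  finally show ?thesis .
next
  case (Some R)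
  interpret lattice "lat P" by (rule lattice_lat)
  have eg: "e \<in> ground P" using S eS carrier_Pow by auto
  note R = phi_SomeD[OF Some]
  let ?M = "R \<sqinter>\<^bsub>lat P\<^esub> S" and ?J = "R \<squnion>\<^bsub>lat P\<^esub> S"
  have M: "?M \<in> carrier (lat P)" and J: "?J \<in> carrier (lat P)"
    using R(1) S by auto
  have MR: "?M \<sqsubseteq>\<^bsub>lat P\<^esub> R" and MS: "?M \<sqsubseteq>\<^bsub>lat P\<^esub> S"
    using R(1) S by (auto intro: meet_left meet_right)
  have SJ: "S \<sqsubseteq>\<^bsub>lat P\<^esub> ?J" and JT: "?J \<sqsubseteq>\<^bsub>lat P\<^esub> T"
    using R(1,2) S T ST by (auto intro: join_right join_le)
  \<comment> \<open>The lattice order need not be inclusion, so \<open>e\<close> is kept out of the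
    meet through the matrix: by (P2) its entry there is at most the entry at \<open>R\<close>, which
    is not positive.\<close>
  have matM: "\<not> 0 < mat P U ?M e"
    using mat_mono[OF U M R(1) MR eg] mat_pos_iff[OF U R(1) eg] R(3) by linarith
  then have eM: "e \<notin> ?M" using mat_pos_iff[OF U M eg] e by blast
  have phiS: "phi P e S = Some ?M"
    unfolding phi_eq_Some_iff greatest_def below_avoiding_def
  proof (intro conjI ballI)
    show "?M \<in> {T \<in> carrier (lat P). T \<sqsubseteq>\<^bsub>lat P\<^esub> S \<and> e \<notin> T}"
      using M MS eM by simp
    fix T' assume "T' \<in> {T \<in> carrier (lat P). T \<sqsubseteq>\<^bsub>lat P\<^esub> S \<and> e \<notin> T}"
    then have T': "T' \<in> carrier (lat P)" "T' \<sqsubseteq>\<^bsub>lat P\<^esub> S" "e \<notin> T'" by auto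
    then have "T' \<sqsubseteq>\<^bsub>lat P\<^esub> R" using R(4) le_trans[OF T'(2) ST] S T by blast
    then show "T' \<sqsubseteq>\<^bsub>lat P\<^esub> ?M" using T' R(1) S by (intro meet_le) auto
  qed blast
  have matS: "0 < mat P U S e" using mat_pos_iff[OF U S eg] e eS by blast
  have matJ: "mat P U S e \<le> mat P U ?J e" by (rule mat_mono[OF U S J SJ eg])
  have SM: "0 \<le> rk P U S - rk P U ?M" using rk_mono[OF U M S MS] by simp
  \<comment> \<open>By (P2) the denominator at the join is at least the one at \<open>S\<close>, and
    the left numerator is nonnegative, so the quotients in (P4) can be replaced by their
    numerators.\<close>
  have gain: "rk P U S - rk P U ?M \<le> rk P U ?J - rk P U R"
  proof -
    have "(rk P U S - rk P U ?M) * mat P U ?J e \<le> (rk P U ?J - rk P U R) * mat P U S e"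
      using rk_gain_le[OF U R(1) S eg matS matM] matS matJ by (simp add: field_simps)
    moreover have "(rk P U S - rk P U ?M) * mat P U S e \<le> (rk P U S - rk P U ?M) * mat P U ?J e"
      using SM matJ by (intro mult_left_mono)
    ultimately show ?thesis
      using matS by (meson mult_le_cancel_right_pos order_trans)
  qed
  \<comment> \<open>Passage to positive parts: if the rank of \<open>R\<close> is positive, clipping
    at 0 can only shrink the left difference; otherwise both subtracted terms vanish and the ranks
    of \<open>S\<close> and \<open>T\<close> are compared directly.\<close>
  have "rk P U ?J \<le> rk P U T" "rk P U R \<le> rk P U T" "rk P U S \<le> rk P U T"
    "rk P U ?M \<le> rk P U R"
    using rk_mono[OF U] R J M S T JT ST MR by auto
  then show ?thesis using gain SM Some phiS by (simp add: rk_drop_def max_def)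
qed

text \<open>Serves to compare a row with the row of \<phi>_e(S), and with the top row that occurs in
  \<delta>.\<close>

lemma trunc_mono:
  assumes U: "U \<in> fam P" and e: "e \<in> ground P"
    and S: "S \<in> carrier (lat P)" and T: "T \<in> carrier (lat P)" and ST: "S \<sqsubseteq>\<^bsub>lat P\<^esub> T"
  shows "trunc P U S e \<le> trunc P U T e"
proof (cases "e \<in> mem P U \<inter> S")
  case True
  then show ?thesis
    unfolding trunc_def using rk_drop_mono[OF U _ S T ST] mat_mono[OF U S T ST e]
    by (intro min.mono) auto
next
  case False
  then show ?thesis using trunc_eq_0[OF U S e] trunc_nonneg[OF U T e] by simp
qed

text \<open>
  If the truncation cuts an entry that is used, then a single unit of that element covers the rank
  down to \<open>\<phi>\<^sub>e(S)\<close>, and the rest of the row dominates the row of \<open>\<phi>\<^sub>e(S)\<close>.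
\<close>

lemma trunc_row_satisfied:
  assumes "feasible P (mat P) z" and U: "U \<in> fam P" and "S \<in> carrier (lat P)"
  shows "rk P U S \<le> (\<Sum>e\<in>ground P. trunc P U S e * real (z e))"
  using \<open>S \<in> carrier (lat P)\<close>
proof (induction "card {T \<in> carrier (lat P). T \<sqsubseteq>\<^bsub>lat P\<^esub> S}" arbitrary: S rule: less_induct)
  case less
  interpret lattice "lat P" by (rule lattice_lat)
  note S = less.prems
  show ?case
  \<comment> \<open>Without such an element, either all used entries are uncut and the original row
    suffices, or the rank is at most 0.\<close>
  proof (cases "\<exists>e\<in>ground P. 0 < z e \<and> trunc P U S e < mat P U S e \<and> 0 < rk P U S")
    case False
    show ?thesis
    proof (cases "0 < rk P U S")
      case True
      with False have "mat P U S e * real (z e) \<le> trunc P U S e * real (z e)"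
        if "e \<in> ground P" for e
        using that by (cases "z e = 0") (auto intro: mult_right_mono simp: not_less)
      then have "(\<Sum>e\<in>ground P. mat P U S e * real (z e))
          \<le> (\<Sum>e\<in>ground P. trunc P U S e * real (z e))"
        by (intro sum_mono)
      then show ?thesis using assms(1) U S unfolding feasible_def rows_def by force
    next
      case False
      moreover have "0 \<le> (\<Sum>e\<in>ground P. trunc P U S e * real (z e))"
        using trunc_nonneg[OF U S] by (intro sum_nonneg) simp
      ultimately show ?thesis by linarith
    qed
  next
    case True
    then obtain e where e: "e \<in> ground P" "0 < z e" "trunc P U S e < mat P U S e"
      and pos: "0 < rk P U S" by blast
    have trunc_e: "trunc P U S e = rk_drop P U S e"
      using e(3) by (auto simp: trunc_def min_def split: if_splits)
    have eS: "e \<in> S"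
      using mat_pos_iff[OF U S e(1)] e(3) trunc_nonneg[OF U S e(1)] by auto
    have split: "(\<Sum>f\<in>ground P. trunc P U S f * real (z f)) =
        trunc P U S e * real (z e) + (\<Sum>f\<in>ground P - {e}. trunc P U S f * real (z f))"
      using finite_ground e(1) by (rule sum.remove)
    have one: "trunc P U S e \<le> trunc P U S e * real (z e)"
      using e(2) trunc_nonneg[OF U S e(1)] mult_left_mono[of 1 "real (z e)" "trunc P U S e"] by simp
    have rest: "0 \<le> (\<Sum>f\<in>ground P - {e}. trunc P U S f * real (z f))"
      using trunc_nonneg[OF U S] by (intro sum_nonneg) simp
    show ?thesis
    proof (cases "phi P e S")
      case None
      then have "trunc P U S e = rk P U S" using trunc_e pos by (simp add: rk_drop_def)
      then show ?thesis using split one rest by linarith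
    next
      case (Some R)
      note R = phi_SomeD[OF Some]
      have "{T \<in> carrier (lat P). T \<sqsubseteq>\<^bsub>lat P\<^esub> R} \<subset> {T \<in> carrier (lat P). T \<sqsubseteq>\<^bsub>lat P\<^esub> S}"
      proof (rule psubsetI)
        show "{T \<in> carrier (lat P). T \<sqsubseteq>\<^bsub>lat P\<^esub> R} \<subseteq> {T \<in> carrier (lat P). T \<sqsubseteq>\<^bsub>lat P\<^esub> S}"
          using le_trans[OF _ R(2)] R(1) S by blast
        \<comment> \<open>Strictness comes from \<open>S\<close> itself: \<open>S\<close> below
          \<open>R\<close> would force equality, but \<open>e\<close> lies only in
          \<open>S\<close>.\<close>
        have "\<not> S \<sqsubseteq>\<^bsub>lat P\<^esub> R" using R eS S le_antisym by blast
        then show "{T \<in> carrier (lat P). T \<sqsubseteq>\<^bsub>lat P\<^esub> R} \<noteq> {T \<in> carrier (lat P). T \<sqsubseteq>\<^bsub>lat P\<^esub> S}"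
          using S le_refl[OF S] by blast
      qed
      then have "rk P U R \<le> (\<Sum>f\<in>ground P. trunc P U R f * real (z f))"
        using less.hyps R(1) finite_carrier by (simp add: psubset_card_mono)
      also have "\<dots> = (\<Sum>f\<in>ground P - {e}. trunc P U R f * real (z f))"
        using finite_ground e(1) trunc_eq_0[OF U R(1) e(1)] R(3) by (simp add: sum.remove)
      also have "\<dots> \<le> (\<Sum>f\<in>ground P - {e}. trunc P U S f * real (z f))"
        using trunc_mono[OF U _ R(1) S R(2)] by (intro sum_mono mult_right_mono) auto
      \<comment> \<open>The rest of the row is at least 0 and at least the rank of \<open>R\<close>,
        hence at least the positive part that \<open>rk_drop\<close> subtracts.\<close>
      finally show ?thesis
        using split one rest trunc_e pos Some by (simp add: rk_drop_def)
    qed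
  qed
qed

section \<open>The run of the algorithm\<close>

text \<open>The dual solution is a nonnegative combination of indicators of raised families, so an
  inequality between \<open>g\<close> and \<open>h\<close> on each family lifts to the
  \<open>y\<close>-weighted sums. Leaving \<open>g\<close>, \<open>h\<close> and \<open>K\<close>
  free serves both the general and the binary bound.\<close>

lemma greedy_run_invariant:
  assumes "greedy_run P Q c y x es Is B" and "\<forall>e\<in>ground P. 0 \<le> c e"
  shows "\<forall>e. e \<notin> set es \<longrightarrow> x e = 0"
    and "\<forall>p. 0 \<le> y p"
    and "\<forall>e\<in>set es. load P y e = c e"
    and "\<forall>e\<in>ground P. load P y e \<le> c e"
    and "\<forall>I\<in>set Is. I \<subseteq> rows P \<and> (\<exists>\<rho>>0. \<forall>(U, S)\<in>I. rk P U S = \<rho>)"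
    and "\<forall>I\<in>set Is. sum g I \<le> K * sum h I \<Longrightarrow>
      (\<Sum>p\<in>rows P. y p * g p) \<le> K * (\<Sum>p\<in>rows P. y p * h p)"
proof -
  \<comment> \<open>The induction also records that rows of the current family avoid all selected
    elements. The truncated entries of these elements in later raised rows are then 0, so tight
    elements stay tight.\<close>
  have "B \<subseteq> rows P \<and> (\<forall>(U, S)\<in>B. S \<inter> set es = {}) \<and> (\<forall>e. e \<notin> set es \<longrightarrow> x e = 0) \<and>
    (\<forall>p. 0 \<le> y p) \<and> set es \<subseteq> ground P \<and> (\<forall>e\<in>set es. load P y e = c e) \<and>
    (\<forall>e\<in>ground P. load P y e \<le> c e) \<and>
    (\<forall>I\<in>set Is. I \<subseteq> rows P \<and> (\<exists>\<rho>>0. \<forall>(U, S)\<in>I. rk P U S = \<rho>)) \<and>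
    ((\<forall>I\<in>set Is. sum g I \<le> K * sum h I) \<longrightarrow>
      (\<Sum>p\<in>rows P. y p * g p) \<le> K * (\<Sum>p\<in>rows P. y p * h p))"
    using assms
  proof (induction rule: greedy_run.induct)
    case start
    then show ?case by (auto simp: load_def)
  next
    case (iteration y x es Is B I S rho eps y' e)
    then have IH: "B \<subseteq> rows P" "\<forall>(U, S)\<in>B. S \<inter> set es = {}" "\<forall>e. e \<notin> set es \<longrightarrow> x e = 0"
      "\<forall>p. 0 \<le> y p" "set es \<subseteq> ground P" "\<forall>e\<in>set es. load P y e = c e"
      "\<forall>e\<in>ground P. load P y e \<le> c e"
      "\<forall>I\<in>set Is. I \<subseteq> rows P \<and> (\<exists>\<rho>>0. \<forall>(U, S)\<in>I. rk P U S = \<rho>)"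
      "(\<forall>I\<in>set Is. sum g I \<le> K * sum h I) \<Longrightarrow>
        (\<Sum>p\<in>rows P. y p * g p) \<le> K * (\<Sum>p\<in>rows P. y p * h p)"
      by auto
    have IB: "I \<subseteq> B" using iteration.hyps(3) by (auto simp: maximal_rows_def)
    have Irows: "I \<subseteq> rows P" using IB IH(1) by blast
    have weight: "(\<Sum>p\<in>rows P. y' p * w p) = (\<Sum>p\<in>rows P. y p * w p) + eps * sum w I" for w
    proof -
      have "(\<Sum>p\<in>rows P. y' p * w p) = (\<Sum>p\<in>rows P. y p * w p + (if p \<in> I then eps * w p else 0))"
        using iteration.hyps(7) by (intro sum.cong) (auto simp: algebra_simps)
      also have "\<dots> = (\<Sum>p\<in>rows P. y p * w p) + (\<Sum>p\<in>rows P \<inter> I. eps * w p)"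
        using finite_rows by (simp add: sum.distrib sum.inter_restrict)
      also have "rows P \<inter> I = I" using Irows by blast
      finally show ?thesis by (simp add: sum_distrib_left)
    qed
    have old: "load P y' f = load P y f" if "f \<in> set es" for f
      unfolding load_def
    proof (rule sum.cong[OF refl], clarify)
      fix U T assume UT: "(U, T) \<in> rows P"
      have "trunc P U T f = 0" if "(U, T) \<in> I"
      proof (rule trunc_eq_0)
        have "(U, T) \<in> B" using that IB by blast
        then have "T \<inter> set es = {}" using IH(2) by auto
        then show "f \<notin> mem P U \<inter> T" using \<open>f \<in> set es\<close> by blast
      qed (use UT IH(5) \<open>f \<in> set es\<close> in \<open>auto simp: rows_def\<close>)
      then show "trunc P U T f * y' (U, T) = trunc P U T f * y (U, T)"
        using iteration.hyps(7) by auto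
    qed
    have "load P y' f \<le> c f" if "f \<in> ground P" for f
      using that old[of f] IH(6) iteration.hyps(8) by (cases "f \<in> set es") auto
    moreover have "(\<Sum>p\<in>rows P. y' p * g p) \<le> K * (\<Sum>p\<in>rows P. y' p * h p)"
      if "\<forall>J\<in>set (Is @ [I]). sum g J \<le> K * sum h J"
    proof -
      have "(\<Sum>p\<in>rows P. y p * g p) \<le> K * (\<Sum>p\<in>rows P. y p * h p)"
        using IH(9) that by simp
      moreover have "eps * sum g I \<le> eps * (K * sum h I)"
        using that iteration.hyps(6) by (intro mult_left_mono) auto
      ultimately show ?thesis unfolding weight by (simp add: algebra_simps)
    qed
    moreover have "\<exists>\<rho>>0. \<forall>(U, S)\<in>I. rk P U S = \<rho>"
      using iteration.hyps(4,5) by fast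
    ultimately show ?case
      using IH old iteration.hyps Irows
      by (auto simp: remove_elem_def)
  qed
  then show "\<forall>e. e \<notin> set es \<longrightarrow> x e = 0" "\<forall>p. 0 \<le> y p" "\<forall>e\<in>set es. load P y e = c e"
    "\<forall>e\<in>ground P. load P y e \<le> c e"
    "\<forall>I\<in>set Is. I \<subseteq> rows P \<and> (\<exists>\<rho>>0. \<forall>(U, S)\<in>I. rk P U S = \<rho>)"
    "\<forall>I\<in>set Is. sum g I \<le> K * sum h I \<Longrightarrow>
      (\<Sum>p\<in>rows P. y p * g p) \<le> K * (\<Sum>p\<in>rows P. y p * h p)"
    by simp_all
qed

text \<open>The right-hand side \<open>h\<close> is left open so that rounded up ranks can replace
  the ranks in the binary case.\<close>

lemma weak_duality:
  assumes "\<forall>p. 0 \<le> y p" "\<forall>e\<in>ground P. load P y e \<le> c e"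
    and "\<And>U S. (U, S) \<in> rows P \<Longrightarrow> h (U, S) \<le> (\<Sum>e\<in>ground P. trunc P U S e * real (z e))"
  shows "(\<Sum>p\<in>rows P. y p * h p) \<le> cost P c z"
proof -
  have "(\<Sum>p\<in>rows P. y p * h p) \<le>
      (\<Sum>p\<in>rows P. y p * (\<Sum>e\<in>ground P. trunc P (fst p) (snd p) e * real (z e)))"
    using assms(1,3) by (intro sum_mono mult_left_mono) auto
  also have "\<dots> = (\<Sum>e\<in>ground P. load P y e * real (z e))"
    by (rule sum_load[symmetric])
  also have "\<dots> \<le> cost P c z"
    unfolding cost_def using assms(2) by (intro sum_mono mult_right_mono) auto
  finally show ?thesis .
qed

section \<open>Witness-covers\<close>

lemma delta_set_finite:
  "finite {delta_entry P U W S e | U W S e.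
     U \<in> fam P \<and> W \<in> fam P \<and> S \<in> carrier (lat P) \<and> e \<in> ground P}" (is "finite ?D")
proof -
  have "?D \<subseteq> (\<lambda>(U, W, S, e). delta_entry P U W S e) `
      (fam P \<times> fam P \<times> carrier (lat P) \<times> ground P)"
    by force
  then show ?thesis
    using finite_fam finite_carrier finite_ground by (meson finite_SigmaI finite_imageI finite_subset)
qed

lemma delta_entry_le_delta:
  assumes "U \<in> fam P" "W \<in> fam P" "S \<in> carrier (lat P)" "e \<in> ground P"
  shows "delta_entry P U W S e \<le> delta P"
  unfolding delta_def using assms by (intro Max_ge delta_set_finite) blast

text \<open>\<open>\<top>\<close> is a choice among the greatest elements of the carrier; uniqueness
  identifies it with the one assumed to exist.\<close>

lemma top_lat:
  shows "\<top>\<^bsub>lat P\<^esub> \<in> carrier (lat P)"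
    and "S \<in> carrier (lat P) \<Longrightarrow> S \<sqsubseteq>\<^bsub>lat P\<^esub> \<top>\<^bsub>lat P\<^esub>"
proof -
  interpret lattice "lat P" by (rule lattice_lat)
  obtain T where T: "greatest (lat P) T (carrier (lat P))" using top_ex by blast
  have "\<top>\<^bsub>lat P\<^esub> = T"
    unfolding top_def using T by (intro some_equality) (auto simp: greatest_unique)
  then show "\<top>\<^bsub>lat P\<^esub> \<in> carrier (lat P)"
    "S \<in> carrier (lat P) \<Longrightarrow> S \<sqsubseteq>\<^bsub>lat P\<^esub> \<top>\<^bsub>lat P\<^esub>"
    using T unfolding greatest_def by auto
qed

lemma delta_nonneg:
  assumes "fam P \<noteq> {}" "ground P \<noteq> {}"
  shows "0 \<le> delta P"
proof -
  obtain U e where Ue: "U \<in> fam P" "e \<in> ground P" using assms by blast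
  have "0 \<le> delta_entry P U U \<top>\<^bsub>lat P\<^esub> e"
    using Ue trunc_nonneg top_lat(1) by (simp add: delta_entry_def)
  also have "\<dots> \<le> delta P" by (rule delta_entry_le_delta[OF Ue(1) Ue(1) top_lat(1) Ue(2)])
  finally show ?thesis .
qed

lemma witnessD:
  assumes "W \<in> fam P" "T \<in> carrier (lat P)" "f \<in> ground P" "witness P x (W, T) f"
  shows "0 < x f"
    and "(\<Sum>e\<in>ground P. trunc P W T e * real (x e)) - trunc P W T f < rk P W T"
    and "rk P W T \<le> (\<Sum>e\<in>ground P. trunc P W T e * real (x e))"
  using assms by (auto simp: witness_def sum_ground_eq_sum_row)

text \<open>
  If \<open>\<delta>\<close> does not control the entry of a used element \<open>e\<close> in the witness row, then this entry is the
  whole rank of the row, and so one unit of \<open>e\<close> is all that \<open>x\<close> uses in the row.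
\<close>

lemma charge_le:
  assumes U: "U \<in> fam P" "S \<in> carrier (lat P)" and W: "W \<in> fam P" "T \<in> carrier (lat P)"
    and e: "e \<in> ground P" and f: "f \<in> ground P"
    and wit: "witness P x (W, T) f" and used: "0 < trunc P W T e * real (x e)"
    and \<rho>: "rk P U S = \<rho>" "0 < \<rho>"
  shows "trunc P U S e * real (x e) \<le>
    delta P * trunc P W T e * (real (x e) - of_bool (e = f)) + \<rho> * of_bool (e = f)"
proof -
  note w = witnessD[OF W f wit]
  have tW: "0 \<le> trunc P W T g" if "g \<in> ground P" for g
    using trunc_nonneg W that by blast
  have pos: "0 < trunc P W T e" "0 < x e"
    using used tW[OF e] by (auto simp: zero_less_mult_iff)
  have t\<rho>: "trunc P U S e \<le> \<rho>" using trunc_le_rk[of P U S e] \<rho> by simp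
  show ?thesis
  proof (cases "(\<exists>R. phi P e T = Some R \<and> 0 \<le> rk P W R) \<or> trunc P W T e = mat P W T e")
    case True
    then have "trunc P U \<top>\<^bsub>lat P\<^esub> e / trunc P W T e \<le> delta P"
      using delta_entry_le_delta[OF U(1) W e] pos(1) by (simp add: delta_entry_def)
    then have "trunc P U \<top>\<^bsub>lat P\<^esub> e \<le> delta P * trunc P W T e"
      using pos(1) by (simp add: divide_le_eq)
    then have le: "trunc P U S e \<le> delta P * trunc P W T e"
      using trunc_mono[OF U(1) e U(2) top_lat(1)] top_lat(2)[OF U(2)] by linarith
    \<comment> \<open>For \<open>e = f\<close> one unit is set aside to be paid by \<rho>. The
      factor stays nonnegative because \<open>x\<close> uses \<open>e\<close>.\<close>
    have "trunc P U S e * (real (x e) - of_bool (e = f))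
        \<le> delta P * trunc P W T e * (real (x e) - of_bool (e = f))"
      using le pos(2) by (intro mult_right_mono) auto
    then show ?thesis using t\<rho> by (auto simp: algebra_simps)
  next
    case False
    \<comment> \<open>The left-hand side contains a unit of \<open>f\<close>; what remains without
      it is nonnegative, yet below the rank.\<close>
    have rW: "0 < rk P W T"
    proof -
      have "trunc P W T f \<le> trunc P W T f * real (x f)"
        using w(1) tW[OF f] mult_left_mono[of 1 "real (x f)" "trunc P W T f"] by simp
      also have "\<dots> \<le> (\<Sum>e\<in>ground P. trunc P W T e * real (x e))"
        using finite_ground f tW by (intro member_le_sum) auto
      finally show ?thesis using w(2) by linarith
    qed
    \<comment> \<open>The entry is cut, so it equals the rank drop, and \<phi>_e(T) is undefined or
      of negative rank, so nothing is subtracted.\<close>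
    have full: "trunc P W T e = rk P W T"
      using False rW by (auto simp: trunc_def rk_drop_def min_def split: option.splits)
    have rem: "(\<Sum>g\<in>ground P. trunc P W T g * real (x g)) =
        trunc P W T e * real (x e) + (\<Sum>g\<in>ground P - {e}. trunc P W T g * real (x g))"
      using finite_ground e by (rule sum.remove)
    \<comment> \<open>Otherwise a unit of \<open>e\<close> survives the removal of a unit of
      \<open>f\<close> and satisfies the row alone, contrary to the witness property.\<close>
    have ef: "e = f"
    proof (rule ccontr)
      assume "e \<noteq> f"
      have "trunc P W T f \<le> trunc P W T f * real (x f)"
        using w(1) tW[OF f] mult_left_mono[of 1 "real (x f)" "trunc P W T f"] by simp
      also have "\<dots> \<le> (\<Sum>g\<in>ground P - {e}. trunc P W T g * real (x g))"
        using finite_ground f tW \<open>e \<noteq> f\<close>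
        by (intro member_le_sum[where f = "\<lambda>g. trunc P W T g * real (x g)"]) auto
      finally have "trunc P W T e * real (x e) < rk P W T"
        using w(2) rem by linarith
      moreover have "rk P W T * 1 \<le> rk P W T * real (x e)"
        using pos(2) rW by (intro mult_left_mono) auto
      ultimately show False using full by simp
    qed
    have "0 \<le> (\<Sum>g\<in>ground P - {e}. trunc P W T g * real (x g))"
      using tW by (intro sum_nonneg) auto
    moreover have "trunc P W T e * real (x e) = rk P W T * real (x e)" "trunc P W T f = rk P W T"
      using full ef by simp_all
    ultimately have "rk P W T * real (x e) - rk P W T < rk P W T"
      using w(2) rem by linarith
    then have "rk P W T * real (x e) < rk P W T * 2" by simp
    then have "x e = 1" using rW pos(2) by (simp add: mult_less_cancel_left_pos)
    then show ?thesis using ef t\<rho> by simp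
  qed
qed

text \<open>For a fixed \<open>e\<close>, the cover has at least as many rows using \<open>e\<close>
  as \<open>I\<close> has, so the terms of \<open>I\<close> can be matched injectively with charges
  to \<open>C\<close>. The charge \<open>w\<close> is abstract because the general and the binary
  bound charge differently.\<close>

lemma sum_rows_le_sum_cover:
  assumes cover: "multiplicity_witness_cover P x I C" and I: "I \<subseteq> rows P"
    and le: "\<And>p q e. p \<in> I \<Longrightarrow> q \<in> C \<Longrightarrow> e \<in> ground P \<Longrightarrow>
      0 < trunc P (fst p) (snd p) e * real (x e) \<Longrightarrow>
      0 < trunc P (fst q) (snd q) e * real (x e) \<Longrightarrow>
      trunc P (fst p) (snd p) e * real (x e) \<le> w q e"
    and nonneg: "\<And>q e. q \<in> C \<Longrightarrow> e \<in> ground P \<Longrightarrow> 0 \<le> w q e"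
  shows "(\<Sum>p\<in>I. \<Sum>e\<in>ground P. trunc P (fst p) (snd p) e * real (x e))
    \<le> (\<Sum>q\<in>C. \<Sum>e\<in>ground P. w q e)"
proof -
  let ?t = "\<lambda>p e. trunc P (fst p) (snd p) e * real (x e)"
  have C: "C \<subseteq> rows P" using cover unfolding multiplicity_witness_cover_def by blast
  have fin: "finite I" "finite C" using I C finite_rows finite_subset by auto
  have "(\<Sum>p\<in>I. ?t p e) \<le> (\<Sum>q\<in>C. w q e)" if e: "e \<in> ground P" for e
  proof -
    have tnn: "0 \<le> ?t p e" if "p \<in> rows P" for p
      using that e trunc_nonneg by (auto simp: rows_def)
    have "card {(U, S)\<in>I. trunc P U S e * real (x e) > 0}
        \<le> card {(U, S)\<in>C. trunc P U S e * real (x e) > 0}"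
      using cover e unfolding multiplicity_witness_cover_def by blast
    then have card: "card {p \<in> I. 0 < ?t p e} \<le> card {p \<in> C. 0 < ?t p e}"
      by (simp add: case_prod_unfold)
    have "(\<Sum>p\<in>I. ?t p e) = (\<Sum>p\<in>{p \<in> I. 0 < ?t p e}. ?t p e)"
    proof (intro sum.mono_neutral_right ballI)
      fix p assume "p \<in> I - {p \<in> I. 0 < ?t p e}"
      then show "?t p e = 0" using tnn[of p] I by (auto intro: antisym)
    qed (use fin in auto)
    also have "\<dots> \<le> (\<Sum>q\<in>{q \<in> C. 0 < ?t q e}. w q e)"
      by (rule sum_le_sum_of_card_le) (use fin card le nonneg e in auto)
    also have "\<dots> \<le> (\<Sum>q\<in>C. w q e)"
      using fin nonneg e by (intro sum_mono2) auto
    finally show ?thesis .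
  qed
  then have "(\<Sum>e\<in>ground P. \<Sum>p\<in>I. ?t p e) \<le> (\<Sum>e\<in>ground P. \<Sum>q\<in>C. w q e)"
    by (rule sum_mono)
  then show ?thesis by (simp only: sum.swap[of _ I] sum.swap[of _ C])
qed

lemma cover_bound:
  assumes cover: "multiplicity_witness_cover P x I C" "card C \<le> k * card I"
    and I: "I \<subseteq> rows P" "\<forall>(U, S)\<in>I. rk P U S = \<rho>" "0 < \<rho>"
    and nonempty: "fam P \<noteq> {}" "ground P \<noteq> {}"
  shows "(\<Sum>p\<in>I. \<Sum>e\<in>ground P. trunc P (fst p) (snd p) e * real (x e))
    \<le> real k * (delta P + 1) * (\<Sum>p\<in>I. rk P (fst p) (snd p))"
proof (cases "I = {}")
  case False
  have C: "C \<subseteq> rows P" "\<forall>q\<in>C. \<exists>f\<in>ground P. witness P x q f"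
    using cover unfolding multiplicity_witness_cover_def by blast+
  have rkC: "rk P (fst q) (snd q) \<le> \<rho>" if "q \<in> C" for q
    using cover(1) that I(2) False unfolding multiplicity_witness_cover_def by fastforce
  obtain f where f: "\<And>q. q \<in> C \<Longrightarrow> f q \<in> ground P \<and> witness P x q (f q)"
    using C(2) by metis
  note \<delta> = delta_nonneg[OF nonempty]
  \<comment> \<open>One unit of the witnessed element is priced separately because the witness
    inequality bounds the row by its rank only after that unit is removed.\<close>
  define w where "w q e = delta P * trunc P (fst q) (snd q) e * (real (x e) - of_bool (e = f q))
    + \<rho> * of_bool (e = f q)" for q e
  have "(\<Sum>p\<in>I. \<Sum>e\<in>ground P. trunc P (fst p) (snd p) e * real (x e))
      \<le> (\<Sum>q\<in>C. \<Sum>e\<in>ground P. w q e)"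
  proof (rule sum_rows_le_sum_cover[OF cover(1) I(1)])
    fix p q e assume "p \<in> I" "q \<in> C" "e \<in> ground P" "0 < trunc P (fst q) (snd q) e * real (x e)"
    then show "trunc P (fst p) (snd p) e * real (x e) \<le> w q e"
      unfolding w_def using f[of q] I C(1)
      by (intro charge_le) (auto simp: rows_def)
  next
    fix q e assume q: "q \<in> C" and e: "e \<in> ground P"
    \<comment> \<open>At \<open>e = f q\<close> this is the positivity clause in
      \<open>witness\<close>.\<close>
    have "real (x e) - of_bool (e = f q) \<ge> 0"
      using f[OF q] by (cases q) (auto simp: witness_def)
    moreover have "0 \<le> trunc P (fst q) (snd q) e"
      using trunc_nonneg q e C(1) by (auto simp: rows_def)
    ultimately show "0 \<le> w q e" unfolding w_def using \<delta> I(3) by simp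
  qed
  also have "\<dots> \<le> (\<Sum>q\<in>C. (delta P + 1) * \<rho>)"
  proof (rule sum_mono)
    fix q assume q: "q \<in> C"
    obtain W T where WT: "q = (W, T)" by (cases q)
    have W: "W \<in> fam P" "T \<in> carrier (lat P)" using q C(1) WT by (auto simp: rows_def)
    have fq: "f q \<in> ground P" "witness P x (W, T) (f q)" using f[OF q] WT by auto
    have "(\<Sum>e\<in>ground P. w q e) =
        (\<Sum>e\<in>ground P. delta P * (trunc P W T e * real (x e))
          + (if e = f q then \<rho> - delta P * trunc P W T e else 0))"
      unfolding w_def WT by (intro sum.cong) (auto simp: algebra_simps)
    also have "\<dots> = delta P * ((\<Sum>e\<in>ground P. trunc P W T e * real (x e)) - trunc P W T (f q)) + \<rho>"
      using finite_ground fq(1) by (simp add: sum.distrib sum_distrib_left algebra_simps)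
    \<comment> \<open>Without one unit of \<open>f q\<close> the row is below its own rank, hence
      below \<rho>.\<close>
    also have "\<dots> \<le> delta P * \<rho> + \<rho>"
      using witnessD(2)[OF W fq] rkC[OF q] WT \<delta> by (intro add_right_mono mult_left_mono) auto
    finally show "(\<Sum>e\<in>ground P. w q e) \<le> (delta P + 1) * \<rho>" by (simp add: algebra_simps)
  qed
  also have "\<dots> = real (card C) * ((delta P + 1) * \<rho>)" by simp
  also have "\<dots> \<le> real (k * card I) * ((delta P + 1) * \<rho>)"
    using cover(2) \<delta> I(3) by (intro mult_right_mono) (auto simp only: of_nat_le_iff, auto)
  also have "(\<Sum>p\<in>I. rk P (fst p) (snd p)) = card I * \<rho>"
    using I(2) by (subst sum.cong[where h = "\<lambda>_. \<rho>"]) auto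
  then have "real (k * card I) * ((delta P + 1) * \<rho>) =
      real k * (delta P + 1) * (\<Sum>p\<in>I. rk P (fst p) (snd p))"
    by simp
  finally show ?thesis .
qed simp

text \<open>Positive entries are all 1, so rows of \<open>I\<close> are charged to covering rows
  entry by entry, without the factor \<delta>.\<close>

lemma binary_cover_bound:
  assumes binary: "\<forall>(U, S)\<in>rows P. \<forall>e\<in>ground P. trunc P U S e \<in> {0, 1}"
    and cover: "multiplicity_witness_cover P x I C" "card C \<le> k * card I"
    and I: "I \<subseteq> rows P" "\<forall>(U, S)\<in>I. rk P U S = \<rho>" "0 < \<rho>"
  shows "(\<Sum>p\<in>I. \<Sum>e\<in>ground P. trunc P (fst p) (snd p) e * real (x e))
    \<le> real k * (\<Sum>p\<in>I. of_int \<lceil>rk P (fst p) (snd p)\<rceil>)"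
proof (cases "I = {}")
  case False
  have C: "C \<subseteq> rows P" "\<forall>q\<in>C. \<exists>f\<in>ground P. witness P x q f"
    using cover unfolding multiplicity_witness_cover_def by blast+
  have rkC: "rk P (fst q) (snd q) \<le> \<rho>" if "q \<in> C" for q
    using cover(1) that I(2) False unfolding multiplicity_witness_cover_def by fastforce
  have bin: "trunc P (fst p) (snd p) e \<in> {0, 1}" if "p \<in> rows P" "e \<in> ground P" for p e
    using binary that by (cases p) auto
  have "(\<Sum>p\<in>I. \<Sum>e\<in>ground P. trunc P (fst p) (snd p) e * real (x e))
      \<le> (\<Sum>q\<in>C. \<Sum>e\<in>ground P. trunc P (fst q) (snd q) e * real (x e))"
  proof (rule sum_rows_le_sum_cover[OF cover(1) I(1)])
    fix p q e
    assume "p \<in> I" "q \<in> C" "e \<in> ground P" "0 < trunc P (fst q) (snd q) e * real (x e)"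
    moreover from this have "p \<in> rows P" "q \<in> rows P" using I(1) C(1) by auto
    ultimately show "trunc P (fst p) (snd p) e * real (x e) \<le> trunc P (fst q) (snd q) e * real (x e)"
      using bin[of p e] bin[of q e] by (auto simp: zero_less_mult_iff)
  next
    fix q e assume "q \<in> C" "e \<in> ground P"
    then show "0 \<le> trunc P (fst q) (snd q) e * real (x e)"
      using bin[of q e] subsetD[OF C(1), of q] by auto
  qed
  also have "\<dots> \<le> (\<Sum>q\<in>C. of_int \<lceil>\<rho>\<rceil>)"
  proof (rule sum_mono)
    fix q assume q: "q \<in> C"
    obtain W T where WT: "q = (W, T)" by (cases q)
    have W: "W \<in> fam P" "T \<in> carrier (lat P)" using q C(1) WT by (auto simp: rows_def)
    obtain f where f: "f \<in> ground P" "witness P x (W, T) f" using C(2) q WT by blast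
    have binW: "\<forall>e\<in>ground P. trunc P W T e \<in> {0, 1}" using bin[of q] q C(1) WT by auto
    obtain n :: int where n: "(\<Sum>e\<in>ground P. trunc P W T e * real (x e)) = of_int n"
      using integral_row_eq_of_int[OF binW] by blast
    \<comment> \<open>The entry of \<open>f\<close> is at most 1, so the integral left-hand side
      exceeds the rank by less than 1.\<close>
    have "of_int n - 1 < rk P W T"
      using witnessD(2)[OF W f] binW[rule_format, OF f(1)] n by auto
    then have "of_int n - 1 < \<rho>" using rkC[OF q] WT by simp
    then have "n \<le> \<lceil>\<rho>\<rceil>" by linarith
    then show "(\<Sum>e\<in>ground P. trunc P (fst q) (snd q) e * real (x e)) \<le> of_int \<lceil>\<rho>\<rceil>"
      using n WT by simp
  qed
  also have "\<dots> = real (card C) * of_int \<lceil>\<rho>\<rceil>" by simp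
  also have "\<dots> \<le> real (k * card I) * of_int \<lceil>\<rho>\<rceil>"
    using cover(2) I(3) by (intro mult_right_mono) (auto simp only: of_nat_le_iff, auto)
  also have "(\<Sum>p\<in>I. of_int \<lceil>rk P (fst p) (snd p)\<rceil>) = card I * (of_int \<lceil>\<rho>\<rceil> :: real)"
    using I(2) by (subst sum.cong[where h = "\<lambda>_. of_int \<lceil>\<rho>\<rceil>"]) auto
  then have "real (k * card I) * of_int \<lceil>\<rho>\<rceil> =
      real k * (\<Sum>p\<in>I. of_int \<lceil>rk P (fst p) (snd p)\<rceil>)"
    by simp
  finally show ?thesis .
qed simp

end

section \<open>Combining tightness, witness-covers and weak duality\<close>

theorem theorem2:
  fixes P :: "('e, 'u) product_system"
    and Q :: "'e set \<Rightarrow> 'u rel"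
    and c :: "'e \<Rightarrow> real"
    and k :: nat
    and x :: "'e \<Rightarrow> nat"
    and y :: "'u \<times> 'e set \<Rightarrow> real"
    and Is :: "('u \<times> 'e set) set list"
    and OPT :: real
  assumes "greedy_product_system P"
    and "\<forall>S\<in>carrier (lat P). partial_order_on (fam P) (Q S)"
    and "\<forall>e\<in>ground P. 0 \<le> c e"
    and "0 < k"
    and "algorithm_output P Q c x y Is"
    and "\<forall>I\<in>set Is. \<exists>C. multiplicity_witness_cover P x I C \<and> card C \<le> k * card I"
    and "is_optimal_value P c OPT"
  shows "cost P c x \<le> real k * (delta P + 1) * OPT \<and>
    ((\<forall>(U, S)\<in>rows P. \<forall>e\<in>ground P. trunc P U S e \<in> {0, 1}) \<longrightarrow> cost P c x \<le> real k * OPT)"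
proof -
  note greedy = assms(1)
  obtain x0 es B where run: "greedy_run P Q c y x0 es Is B" and x: "x = cleanup P es x0"
    using assms(5) unfolding algorithm_output_def by blast
  note inv = greedy_run_invariant[OF greedy run assms(3)]
  obtain z where z: "feasible P (mat P) z" "cost P c z = OPT"
    using assms(7) unfolding is_optimal_value_def by blast
  define g where "g p = (\<Sum>e\<in>ground P. trunc P (fst p) (snd p) e * real (x e))" for p
  have trunc_z: "rk P U S \<le> (\<Sum>e\<in>ground P. trunc P U S e * real (z e))"
    if "(U, S) \<in> rows P" for U S
    using trunc_row_satisfied[OF greedy z(1)] that by (simp add: rows_def)
  have xes: "x e = 0" if "e \<notin> set es" for e
    using that inv(1) cleanup_other[OF that, of P x0] x by simp
  have "cost P c x = (\<Sum>e\<in>ground P. load P y e * real (x e))"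
    unfolding cost_def using xes inv(3) by (intro sum.cong) (auto, metis mult_eq_0_iff of_nat_0)
  then have cost_x: "cost P c x = (\<Sum>p\<in>rows P. y p * g p)"
    by (simp add: sum_load g_def)
  have cover: "\<exists>C \<rho>. multiplicity_witness_cover P x I C \<and> card C \<le> k * card I \<and>
      I \<subseteq> rows P \<and> (\<forall>(U, S)\<in>I. rk P U S = \<rho>) \<and> 0 < \<rho>" if "I \<in> set Is" for I
    using bspec[OF assms(6) that] bspec[OF inv(5) that] by iprover
  have "cost P c x \<le> real k * (delta P + 1) * OPT"
  \<comment> \<open>Here \<open>delta P\<close> would be a maximum over the empty set, so the cost
    and OPT are both shown to be 0.\<close>
  proof (cases "fam P = {} \<or> ground P = {}")
    case True
    have "cost P c x = 0"
      using True
    proof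
      assume "fam P = {}"
      then show ?thesis using cost_x by (simp add: rows_def)
    qed (simp add: cost_def)
    moreover have "OPT = 0"
      using True
    proof
      assume "fam P = {}"
      then have "feasible P (mat P) (\<lambda>_. 0)" by (simp add: feasible_def rows_def)
      then have "OPT \<le> cost P c (\<lambda>_. 0)" using assms(7) unfolding is_optimal_value_def by blast
      moreover have "0 \<le> cost P c z" using assms(3) by (simp add: cost_def sum_nonneg)
      ultimately show "OPT = 0" using z(2) by (simp add: cost_def)
    qed (use z(2) in \<open>simp add: cost_def\<close>)
    ultimately show ?thesis by simp
  next
    case False
    let ?h = "\<lambda>p. rk P (fst p) (snd p)"
    have "\<forall>I\<in>set Is. sum g I \<le> real k * (delta P + 1) * sum ?h I"
    proof
      fix I assume "I \<in> set Is"
      from cover[OF this] obtain C \<rho> where C: "multiplicity_witness_cover P x I C"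
        "card C \<le> k * card I" "I \<subseteq> rows P" "\<forall>(U, S)\<in>I. rk P U S = \<rho>" "0 < \<rho>"
        by (elim exE conjE)
      show "sum g I \<le> real k * (delta P + 1) * sum ?h I"
        unfolding g_def by (rule cover_bound[OF greedy C]) (use False in auto)
    qed
    then have "cost P c x \<le> real k * (delta P + 1) * (\<Sum>p\<in>rows P. y p * ?h p)"
      unfolding cost_x by (rule inv(6))
    also have "\<dots> \<le> real k * (delta P + 1) * OPT"
    proof (rule mult_left_mono)
      show "(\<Sum>p\<in>rows P. y p * ?h p) \<le> OPT"
        unfolding z(2)[symmetric] by (rule weak_duality[OF greedy inv(2,4)]) (simp add: trunc_z)
      show "0 \<le> real k * (delta P + 1)" using delta_nonneg[OF greedy] False by simp
    qed
    finally show ?thesis .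
  qed
  moreover have "cost P c x \<le> real k * OPT"
    if binary: "\<forall>(U, S)\<in>rows P. \<forall>e\<in>ground P. trunc P U S e \<in> {0, 1}"
  proof -
    let ?h = "\<lambda>p. of_int \<lceil>rk P (fst p) (snd p)\<rceil> :: real"
    \<comment> \<open>At the integer point \<open>z\<close> a binary row has an integral left-hand
      side, so being at least the rank means being at least the rounded up rank.\<close>
    have ceil_z: "of_int \<lceil>rk P U S\<rceil> \<le> (\<Sum>e\<in>ground P. trunc P U S e * real (z e))"
      if US: "(U, S) \<in> rows P" for U S
    proof -
      obtain n :: int where n: "(\<Sum>e\<in>ground P. trunc P U S e * real (z e)) = of_int n"
        using integral_row_eq_of_int[of P U S] binary US by blast
      then show ?thesis using trunc_z[OF US] by (simp add: ceiling_le_iff)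
    qed
    have "\<forall>I\<in>set Is. sum g I \<le> real k * sum ?h I"
    proof
      fix I assume "I \<in> set Is"
      from cover[OF this] obtain C \<rho> where C: "multiplicity_witness_cover P x I C"
        "card C \<le> k * card I" "I \<subseteq> rows P" "\<forall>(U, S)\<in>I. rk P U S = \<rho>" "0 < \<rho>"
        by (elim exE conjE)
      show "sum g I \<le> real k * sum ?h I"
        unfolding g_def by (rule binary_cover_bound[OF greedy binary C])
    qed
    then have "cost P c x \<le> real k * (\<Sum>p\<in>rows P. y p * ?h p)"
      unfolding cost_x by (rule inv(6))
    also have "\<dots> \<le> real k * OPT"
      unfolding z(2)[symmetric]
      by (intro mult_left_mono weak_duality[OF greedy inv(2,4)]) (simp_all add: ceil_z)
    finally show ?thesis .
  qed
  ultimately show ?thesis by blast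
qed

end
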